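(* Let $(U,L)$ be a pair of irreducible transition matrices on $\mathbb N$, $U$ almost upper-triangular and $L$ almost lower-triangular, which are time-reversal of each other, i.e. $L_{i,j}=\pi_jU_{j,i}/\pi_i$ for all $i,j\ge0$, where $\pi$ is the invariant measure of $U$ (unique up to a positive factor). For any $b\ge0$ set $$Z_b:=\prod_{j=1}^{b}\frac{L_{j-1,j}}{U_{j,j-1}},\qquad Z'_b:=\prod_{j=1}^{b}\frac{U_{j-1,j}}{L_{j,j-1}},$$ where $Z_0=Z_0'=1$ (compatible with the convention concerning empty products). Then: (i) for any $a\ge0$, $\det(\mathrm{Id}-L_{[0,a-1]})=\prod_{j=0}^{a-1}L_{j,j+1}$ (with the convention $\det(\mathrm{Id}-L_{[0,-1]})=1$); (ii) for any $b\ge0$, $Z_b=Z'_b$; (iii) the measure $(Z_0,Z_1,Z_2,\dots)$ is invariant by both $U$ and $L$.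
   Context: $\mathbb N=\{0,1,2,\dots\}$. A transition matrix $M=[M_{i,j}]_{i,j\ge0}$ on $\mathbb N$ (non-negative entries, each row summing to $1$) is almost upper-triangular if $M_{i,j}>0\Rightarrow j\ge i-1$, and almost lower-triangular if $M_{i,j}>0\Rightarrow j\le i+1$. A non-negative measure $\pi$ on $\mathbb N$, with total mass strictly positive or infinite, is invariant by $M$ if $\sum_{a}\pi_aM_{a,b}=\pi_b$ for all $b\in\mathbb N$. An irreducible almost upper-triangular transition matrix has a unique invariant measure up to a positive factor, and it is positive. $M_{[a,b]}=[M_{i,j}]_{a\le i,j\le b}$ and $\mathrm{Id}$ is the identity matrix of the appropriate size.
   Formalization: In (ii), Z_b = Z'_b is stated only for those b with L_{j,j-1} ≠ 0 for all 1 ≤ j ≤ b; otherwise a factor of Z'_b is 0/0 and Z'_b is undefined, which the hypotheses do not exclude (e.g. U_{0,2}=1 and U_{i,i-1}=2/3, U_{i,i+1}=1/3 for i ≥ 1). *)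

theory Defs
  imports Complex_Main "Jordan_Normal_Form.Determinant"
begin

definition transition_matrix :: "(nat \<Rightarrow> nat \<Rightarrow> real) \<Rightarrow> bool" where
  "transition_matrix M \<longleftrightarrow> (\<forall>i j. 0 \<le> M i j) \<and> (\<forall>i. (\<lambda>j. M i j) sums 1)"

definition irreducible_matrix :: "(nat \<Rightarrow> nat \<Rightarrow> real) \<Rightarrow> bool" where
  "irreducible_matrix M \<longleftrightarrow> (\<forall>i j. (i, j) \<in> {(k, l). M k l > 0}\<^sup>*)"

(* j \<ge> i - 1, written without truncated subtraction *)
definition almost_upper_triangular :: "(nat \<Rightarrow> nat \<Rightarrow> real) \<Rightarrow> bool" where
  "almost_upper_triangular M \<longleftrightarrow> (\<forall>i j. M i j > 0 \<longrightarrow> i \<le> j + 1)"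

definition almost_lower_triangular :: "(nat \<Rightarrow> nat \<Rightarrow> real) \<Rightarrow> bool" where
  "almost_lower_triangular M \<longleftrightarrow> (\<forall>i j. M i j > 0 \<longrightarrow> j \<le> i + 1)"

(* For a non-negative measure, positive or infinite total mass means that
   at least one atom has positive mass. *)
definition invariant_measure :: "(nat \<Rightarrow> nat \<Rightarrow> real) \<Rightarrow> (nat \<Rightarrow> real) \<Rightarrow> bool" where
  "invariant_measure M \<pi> \<longleftrightarrow>
     (\<forall>a. 0 \<le> \<pi> a) \<and> (\<exists>a. 0 < \<pi> a) \<and> (\<forall>b. (\<lambda>a. \<pi> a * M a b) sums \<pi> b)"

(* M_{[0,n-1]}; for n = 0 this is the empty matrix, whose determinant is 1. *)
definition leading_block :: "(nat \<Rightarrow> nat \<Rightarrow> real) \<Rightarrow> nat \<Rightarrow> real mat" where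
  "leading_block M n = mat n n (\<lambda>(i, j). M i j)"

definition Z :: "(nat \<Rightarrow> nat \<Rightarrow> real) \<Rightarrow> (nat \<Rightarrow> nat \<Rightarrow> real) \<Rightarrow> nat \<Rightarrow> real" where
  "Z U L b = (\<Prod>j = 1..b. L (j - 1) j / U j (j - 1))"

(* Unlike the U j (j - 1) in Z, which irreducibility forces to be positive, the
   denominators L j (j - 1) can vanish (with the numerators U (j - 1) j), because
   an almost upper-triangular U may jump over j. Z' U L b is the intended quantity
   only if L j (j - 1) \<noteq> 0 for all 1 \<le> j \<le> b. *)
definition Z' :: "(nat \<Rightarrow> nat \<Rightarrow> real) \<Rightarrow> (nat \<Rightarrow> nat \<Rightarrow> real) \<Rightarrow> nat \<Rightarrow> real" where
  "Z' U L b = (\<Prod>j = 1..b. U (j - 1) j / L j (j - 1))"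

end

theory Submission imports Defs begin

text \<open>
  A state of mass zero would have a zero row in the reversal \<open>L\<close>, which is impossible for a
  stochastic matrix; so \<open>\<pi>\<close> is positive and detailed balance \<open>\<pi> i * L i j = \<pi> j * U j i\<close> holds.
  Consequently \<open>\<pi>\<close> is invariant for \<open>L\<close> because the rows of \<open>U\<close> sum to one, and every factor of \<open>Z\<close>,
  as well as every factor of \<open>Z'\<close> with non-vanishing denominator, equals \<open>\<pi> j / \<pi> (j - 1)\<close>. These ratios
  telescope to \<open>\<pi> b / \<pi> 0\<close>, a multiple of \<open>\<pi>\<close>. The denominators of \<open>Z\<close> do not vanish, since a chain
  that descends by at most one at each step can leave \<open>{j<..}\<close> only through the transition from
  \<open>j + 1\<close> to \<open>j\<close>.

  For the determinant, replace each column of \<open>1 - L\<close> by the sum of the columns up to it; this is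
  multiplication by the unitriangular matrix \<open>upper_ones\<close>. Row \<open>i\<close> of \<open>L\<close> is supported on \<open>{..i + 1}\<close>
  and sums to one, so the partial row sums of \<open>1 - L\<close> vanish beyond the diagonal and equal
  \<open>L i (i + 1)\<close> on it: the product is triangular with exactly the claimed diagonal.
\<close>

lemma almost_lower_triangular_eq_0:
  assumes "transition_matrix M" "almost_lower_triangular M" "i + 1 < j"
  shows "M i j = 0"
  using assms unfolding transition_matrix_def almost_lower_triangular_def
  by (metis linorder_not_le order_le_less)

lemma almost_lower_triangular_row_sum:
  assumes "transition_matrix M" "almost_lower_triangular M" "i < j"
  shows "(\<Sum>k\<le>j. M i k) = 1"
proof -
  have "(\<lambda>k. M i k) sums (\<Sum>k\<le>j. M i k)"
    by (rule sums_finite) (use assms(3) in \<open>auto intro!: almost_lower_triangular_eq_0[OF assms(1,2)]\<close>)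
  moreover have "(\<lambda>k. M i k) sums 1"
    using assms(1) by (simp add: transition_matrix_def)
  ultimately show ?thesis
    by (rule sums_unique2)
qed

definition upper_ones :: "nat \<Rightarrow> real mat" where
  "upper_ones n = mat n n (\<lambda>(i, j). if i \<le> j then 1 else 0)"

lemma det_upper_ones: "det (upper_ones n) = 1"
proof -
  have "det (upper_ones n) = prod_list (diag_mat (upper_ones n))"
    by (rule det_upper_triangular[where n = n]) (auto simp: upper_ones_def)
  then show ?thesis
    by (simp add: prod_list_diag_prod upper_ones_def)
qed

lemma mult_upper_ones_index:
  assumes "A \<in> carrier_mat n n" "i < n" "j < n"
  shows "(A * upper_ones n) $$ (i, j) = (\<Sum>k\<le>j. A $$ (i, k))"
proof -
  have "(A * upper_ones n) $$ (i, j) = (\<Sum>k<n. if k \<le> j then A $$ (i, k) else 0)"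
    using assms by (auto simp: upper_ones_def scalar_prod_def atLeast0LessThan intro!: sum.cong)
  also have "\<dots> = (\<Sum>k\<le>j. A $$ (i, k))"
    using assms by (intro sum.mono_neutral_cong_right) auto
  finally show ?thesis .
qed

text \<open>Summing columns from the left makes \<open>1 - M\<close> lower triangular, since the mass of row \<open>i\<close> is
  exhausted at column \<open>i + 1\<close>; on the diagonal only the mass \<open>M i (i + 1)\<close> is still missing.\<close>

lemma det_one_minus_leading_block:
  assumes "transition_matrix M" "almost_lower_triangular M"
  shows "det (1\<^sub>m n - leading_block M n) = (\<Prod>j<n. M j (j + 1))"
proof -
  define A where "A = 1\<^sub>m n - leading_block M n"
  have A: "A \<in> carrier_mat n n"
    by (simp add: A_def leading_block_def minus_carrier_mat)
  have P: "upper_ones n \<in> carrier_mat n n"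
    by (simp add: upper_ones_def)
  have entry: "(A * upper_ones n) $$ (i, j) = (if i \<le> j then 1 else 0) - (\<Sum>k\<le>j. M i k)"
    if "i < n" "j < n" for i j
  proof -
    have "(A * upper_ones n) $$ (i, j) = (\<Sum>k\<le>j. A $$ (i, k))"
      by (rule mult_upper_ones_index[OF A that])
    also have "\<dots> = (\<Sum>k\<le>j. (if i = k then 1 else 0) - M i k)"
      using that by (intro sum.cong) (auto simp: A_def leading_block_def)
    also have "\<dots> = (if i \<le> j then 1 else 0) - (\<Sum>k\<le>j. M i k)"
      by (simp add: sum_subtractf)
    finally show ?thesis .
  qed
  have above: "(A * upper_ones n) $$ (i, j) = 0" if "i < j" "j < n" for i j
    using that entry[of i j] almost_lower_triangular_row_sum[OF assms] by simp
  have diag: "(A * upper_ones n) $$ (i, i) = M i (i + 1)" if "i < n" for i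
    using that entry[of i i] almost_lower_triangular_row_sum[OF assms, of i "Suc i"] by simp
  have "det A = det (A * upper_ones n)"
    by (simp add: det_mult[OF A P] det_upper_ones)
  also have "\<dots> = prod_list (diag_mat (A * upper_ones n))"
    by (rule det_lower_triangular[OF above]) (use A P in auto)
  also have "\<dots> = (\<Prod>j<n. (A * upper_ones n) $$ (j, j))"
    using A by (simp add: prod_list_diag_prod atLeast0LessThan)
  also have "\<dots> = (\<Prod>j<n. M j (j + 1))"
    by (intro prod.cong) (auto simp: diag)
  finally show ?thesis
    by (simp add: A_def)
qed

text \<open>Without the transition from \<open>j + 1\<close> to \<open>j\<close>, a chain that never descends by more than one would be
  trapped in \<open>{j<..}\<close>.\<close>

lemma almost_upper_triangular_subdiagonal_pos:
  assumes "irreducible_matrix M" "almost_upper_triangular M"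
  shows "0 < M (Suc j) j"
proof (rule ccontr)
  assume no_exit: "\<not> 0 < M (Suc j) j"
  have "j < l" if "(Suc j, l) \<in> {(k, l). M k l > 0}\<^sup>*" for l
    using that
  proof (induction rule: rtrancl_induct)
    case (step k l)
    then have "k \<le> l + 1" "\<not> (k = Suc j \<and> l = j)"
      using assms(2) no_exit by (auto simp: almost_upper_triangular_def)
    with step.IH show ?case
      by linarith
  qed simp
  moreover have "(Suc j, j) \<in> {(k, l). M k l > 0}\<^sup>*"
    using assms(1) by (simp add: irreducible_matrix_def)
  ultimately show False
    by blast
qed

text \<open>Division by a zero mass would give \<open>L\<close> a zero row, so a stochastic reversal forces positivity.\<close>

lemma reversal_measure_pos:
  assumes "transition_matrix L" "invariant_measure U \<pi>"
    and "\<And>i j. L i j = \<pi> j * U j i / \<pi> i"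
  shows "0 < \<pi> i"
proof (rule ccontr)
  assume "\<not> 0 < \<pi> i"
  moreover have "0 \<le> \<pi> i"
    using assms(2) by (simp add: invariant_measure_def)
  ultimately have "\<And>j. L i j = 0"
    by (simp add: assms(3))
  then have "(\<lambda>j. L i j) sums 0"
    by simp
  moreover have "(\<lambda>j. L i j) sums 1"
    using assms(1) by (simp add: transition_matrix_def)
  ultimately show False
    using sums_unique2 by fastforce
qed

lemma invariant_measure_reversal:
  assumes "transition_matrix U" "\<And>i. 0 < \<pi> i"
    and "\<And>i j. L i j = \<pi> j * U j i / \<pi> i"
  shows "invariant_measure L \<pi>"
proof -
  have "(\<lambda>a. \<pi> a * L a b) sums \<pi> b" for b
  proof -
    have "(\<lambda>a. \<pi> b * U b a) sums (\<pi> b * 1)"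
      using assms(1) by (intro sums_mult) (simp add: transition_matrix_def)
    moreover have "\<pi> a * L a b = \<pi> b * U b a" for a
      using assms(2)[of a] by (simp add: assms(3))
    ultimately show ?thesis
      by simp
  qed
  then show ?thesis
    using assms(2) by (auto simp: invariant_measure_def intro: less_imp_le)
qed

lemma invariant_measure_divide:
  assumes "invariant_measure M \<pi>" "0 < c"
  shows "invariant_measure M (\<lambda>b. \<pi> b / c)"
proof -
  obtain a where "0 < \<pi> a"
    using assms(1) by (auto simp: invariant_measure_def)
  then have "0 < \<pi> a / c"
    using assms(2) by simp
  moreover have "(\<lambda>a. \<pi> a / c * M a b) sums (\<pi> b / c)" for b
    using assms(1) sums_divide[of "\<lambda>a. \<pi> a * M a b" "\<pi> b" c]
    by (simp add: invariant_measure_def)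
  ultimately show ?thesis
    using assms by (auto simp: invariant_measure_def)
qed

lemma prod_ratio_telescope:
  fixes f :: "nat \<Rightarrow> 'a::field"
  assumes "\<And>i. f i \<noteq> 0"
  shows "(\<Prod>j = 1..b. f j / f (j - 1)) = f b / f 0"
  by (induction b) (simp_all add: assms)

lemma Z_eq_ratio:
  assumes "\<And>i. 0 < \<pi> i" "\<And>i j. L i j = \<pi> j * U j i / \<pi> i" "\<And>j. U (Suc j) j \<noteq> 0"
  shows "Z U L b = \<pi> b / \<pi> 0"
proof -
  have nz: "\<pi> i \<noteq> 0" for i
    using assms(1)[of i] by simp
  have "L (j - 1) j / U j (j - 1) = \<pi> j / \<pi> (j - 1)" if "j \<in> {1..b}" for j
    using that assms(3)[of "j - 1"] by (simp add: assms(2))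
  then show ?thesis
    unfolding Z_def prod_ratio_telescope[of \<pi>, OF nz, symmetric] by (intro prod.cong) auto
qed

lemma Z'_eq_ratio:
  assumes "\<And>i. 0 < \<pi> i" "\<And>i j. L i j = \<pi> j * U j i / \<pi> i" "\<forall>j\<in>{1..b}. L j (j - 1) \<noteq> 0"
  shows "Z' U L b = \<pi> b / \<pi> 0"
proof -
  have nz: "\<pi> i \<noteq> 0" for i
    using assms(1)[of i] by simp
  have "U (j - 1) j / L j (j - 1) = \<pi> j / \<pi> (j - 1)" if "j \<in> {1..b}" for j
  proof -
    have "U (j - 1) j \<noteq> 0"
      using assms(3) that by (auto simp: assms(2))
    then show ?thesis
      by (simp add: assms(2))
  qed
  then show ?thesis
    unfolding Z'_def prod_ratio_telescope[of \<pi>, OF nz, symmetric] by (intro prod.cong) auto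
qed

theorem proposition3p3:
  fixes U L :: "nat \<Rightarrow> nat \<Rightarrow> real" and \<pi> :: "nat \<Rightarrow> real"
  assumes "transition_matrix U" and "irreducible_matrix U" and "almost_upper_triangular U"
    and "transition_matrix L" and "irreducible_matrix L" and "almost_lower_triangular L"
    and "invariant_measure U \<pi>"
    and "\<forall>i j. L i j = \<pi> j * U j i / \<pi> i"
  shows "(\<forall>a. det (1\<^sub>m a - leading_block L a) = (\<Prod>j<a. L j (j + 1)))
    \<and> (\<forall>b. (\<forall>j\<in>{1..b}. L j (j - 1) \<noteq> 0) \<longrightarrow> Z U L b = Z' U L b)
    \<and> invariant_measure U (Z U L) \<and> invariant_measure L (Z U L)"
proof -
  have rev: "\<And>i j. L i j = \<pi> j * U j i / \<pi> i"
    using assms(8) by blast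
  have pos: "\<And>i. 0 < \<pi> i"
    by (rule reversal_measure_pos[OF assms(4,7) rev])
  have "U (Suc j) j \<noteq> 0" for j
    using almost_upper_triangular_subdiagonal_pos[OF assms(2,3), of j] by simp
  then have Z: "Z U L = (\<lambda>b. \<pi> b / \<pi> 0)"
    using Z_eq_ratio[of \<pi>, OF pos rev] by blast
  have "Z U L b = Z' U L b" if "\<forall>j\<in>{1..b}. L j (j - 1) \<noteq> 0" for b
    using Z'_eq_ratio[of \<pi>, OF pos rev that] by (simp add: Z)
  moreover have "invariant_measure U (Z U L)"
    unfolding Z by (rule invariant_measure_divide[OF assms(7) pos])
  moreover have "invariant_measure L (Z U L)"
    unfolding Z by (rule invariant_measure_divide[OF invariant_measure_reversal[OF assms(1) pos rev] pos])
  ultimately show ?thesis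
    using det_one_minus_leading_block[OF assms(4,6)] by blast
qed

end
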